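(* Let $n\in\mathbb{N}$ and $u,v,x,y\in\mathbb{R}^n$ be such that $\lambda:=(u^Tx)(y^Tv)\neq0$ and $u_1,v_n,x_1,y_n\neq0$. Let $$M=\mathcal{X}_{2n}\begin{pmatrix}\mathcal{O}_n & vu^T\\ xy^T & \mathcal{O}_n\end{pmatrix}\mathcal{X}_{2n},$$ and let $\tilde P_1,\tilde P_2\in\mathbb{R}^{2n\times2}$ be the matrices constructed from $u,v,x,y$ in the context. Then $$P=\mathcal{I}_{2n}+\left(\mathcal{O}_{2n,n-1}\mid\tilde P_1\mid\mathcal{O}_{2n,n-1}\right)+\begin{pmatrix}\mathcal{O}_{n-1,2n}\\ \tilde P_2^T\\ \mathcal{O}_{n-1,2n}\end{pmatrix}$$ is a two-sided eigenvector matrix for $M^2$, so that $$M^2P=P\,\operatorname{diag}(0_{n-1},\lambda1_2,0_{n-1})\quad\text{and}\quad PM^2=\operatorname{diag}(0_{n-1},\lambda1_2,0_{n-1})\,P.$$ Moreover, $P$ has the inverse $$P^{-1}=\operatorname{diag}(1_{n-1},0_2,1_{n-1})-\frac{M^2}{\lambda}.$$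
   Context: $\mathcal{I}_m$ is the $m\times m$ unit matrix, $\mathcal{O}_m$ and $\mathcal{O}_{k,l}$ are the $m\times m$ and $k\times l$ null matrices, $1_m$ and $0_m$ are the vectors in $\mathbb{R}^m$ with all entries $1$ and $0$, respectively, $\mathcal{J}_m=(\delta_{i,m+1-j})_{i,j=1}^m$ is the matrix with ones on the antidiagonal and zeros elsewhere, and $$\mathcal{X}_{2n}=\frac1{\sqrt2}\begin{pmatrix}\mathcal{I}_n & \mathcal{J}_n\\ \mathcal{J}_n & -\mathcal{I}_n\end{pmatrix}.$$ $\operatorname{diag}(\cdot)$ denotes the diagonal matrix whose diagonal is the concatenation of the listed vectors; $(\cdot\mid\cdot\mid\cdot)$ denotes horizontal juxtaposition of matrices. Vectors are columns. Define the $2n\times2$ matrices $$P_1=\begin{pmatrix}v & -\mathcal{J}_nx\\ \mathcal{J}_nv & x\end{pmatrix},\qquad P_2=\begin{pmatrix}y & -\mathcal{J}_nu\\ \mathcal{J}_ny & u\end{pmatrix},$$ whose two central rows (rows $n$ and $n+1$) form the $2\times2$ matrices $$A_1=\begin{pmatrix}v_n & -x_1\\ v_n & x_1\end{pmatrix},\qquad A_2=\begin{pmatrix}y_n & -u_1\\ y_n & u_1\end{pmatrix},$$ which are regular under the hypotheses of the claim. Set $\tilde P_1=-P_1A_1^{-1}$ and $\tilde P_2=-P_2A_2^{-1}$. A two-sided eigenvector matrix is one whose columns are right eigenvectors and whose rows are left eigenvectors of the given matrix. *)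

theory Defs
  imports Complex_Main
    "Jordan_Normal_Form.Gauss_Jordan_Elimination"
    "Jordan_Normal_Form.Char_Poly"
begin

definition append_cols :: "'a :: zero mat \<Rightarrow> 'a mat \<Rightarrow> 'a mat" (infixr \<open>@\<^sub>c\<close> 65) where
  "A @\<^sub>c B = four_block_mat A B (0\<^sub>m 0 (dim_col A)) (0\<^sub>m 0 (dim_col B))"

definition ones_vec :: "nat \<Rightarrow> 'a :: one vec" where
  "ones_vec m = vec m (\<lambda>_. 1)"

definition diag_of_vec :: "'a :: zero vec \<Rightarrow> 'a mat" where
  "diag_of_vec w = mat_diag (dim_vec w) (\<lambda>i. w $ i)"

definition outer_prod :: "'a :: semiring_0 vec \<Rightarrow> 'a vec \<Rightarrow> 'a mat" where
  "outer_prod v u = mat_of_cols (dim_vec v) [v] * mat_of_row u"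

(* Indices start at 0, so the antidiagonal is i + j = m - 1. *)
definition J_mat :: "nat \<Rightarrow> real mat" where
  "J_mat m = mat m m (\<lambda>(i,j). if i + j + 1 = m then 1 else 0)"

definition X_mat :: "nat \<Rightarrow> real mat" where
  "X_mat n = (1 / sqrt 2) \<cdot>\<^sub>m four_block_mat (1\<^sub>m n) (J_mat n) (J_mat n) (- 1\<^sub>m n)"

definition M_mat :: "nat \<Rightarrow> real vec \<Rightarrow> real vec \<Rightarrow> real vec \<Rightarrow> real vec \<Rightarrow> real mat" where
  "M_mat n u v x y =
     X_mat n * four_block_mat (0\<^sub>m n n) (outer_prod v u) (outer_prod x y) (0\<^sub>m n n) * X_mat n"

(* P_cols n a b = (a, -J b; J a, b) is instantiated twice: P_cols n v x gives right
   eigenvectors of M^2 and P_cols n y u gives left eigenvectors. A_center n a b is the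
   2 x 2 block formed by its two central rows (proved below). *)
definition P_cols :: "nat \<Rightarrow> real vec \<Rightarrow> real vec \<Rightarrow> real mat" where
  "P_cols n a b = mat_of_cols (2 * n) [a @\<^sub>v (J_mat n *\<^sub>v a), (- (J_mat n *\<^sub>v b)) @\<^sub>v b]"

definition A_center :: "nat \<Rightarrow> real vec \<Rightarrow> real vec \<Rightarrow> real mat" where
  "A_center n a b = mat_of_rows_list 2
     [[a $ (n - 1), - b $ 0],
      [a $ (n - 1),   b $ 0]]"

lemma A_center_central_rows:
  assumes "n \<ge> 1" "a \<in> carrier_vec n" "b \<in> carrier_vec n"
  shows "A_center n a b = mat_of_rows 2 [row (P_cols n a b) (n - 1), row (P_cols n a b) n]"
proof (rule eq_matI)
  have J: "(J_mat n *\<^sub>v w) $ i = w $ (n - 1 - i)" if "w \<in> carrier_vec n" "i < n" for w i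
  proof -
    have "(J_mat n *\<^sub>v w) $ i = (\<Sum>j\<in>{0..<n}. (if i + j + 1 = n then 1 else 0) * w $ j)"
      using that by (simp add: J_mat_def scalar_prod_def)
    also have "\<dots> = (\<Sum>j\<in>{0..<n}. if j = n - 1 - i then w $ j else 0)"
      using that by (intro sum.cong) auto
    also have "\<dots> = w $ (n - 1 - i)"
      using that by (simp add: sum.delta)
    finally show ?thesis .
  qed
  have d: "dim_vec (J_mat n *\<^sub>v w) = n" for w by (simp add: J_mat_def)
  fix i j
  assume "i < dim_row (mat_of_rows 2 [row (P_cols n a b) (n - 1), row (P_cols n a b) n])"
    "j < dim_col (mat_of_rows 2 [row (P_cols n a b) (n - 1), row (P_cols n a b) n])"
  hence "i = 0 \<or> i = 1" "j = 0 \<or> j = 1" by auto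
  thus "A_center n a b $$ (i, j) =
      mat_of_rows 2 [row (P_cols n a b) (n - 1), row (P_cols n a b) n] $$ (i, j)"
    using assms J[of a 0] J[of b "n - 1"] d
    by (auto simp: A_center_def mat_of_rows_list_def mat_of_rows_def P_cols_def mat_of_cols_def)
qed (auto simp: A_center_def mat_of_rows_list_def)

(* Only used for matrices that have an inverse; otherwise the value is unspecified. *)
definition inv_mat :: "'a :: field mat \<Rightarrow> 'a mat" where
  "inv_mat A = the (mat_inverse A)"

lemma inv_mat_A_center:
  assumes "a $ (n - 1) \<noteq> 0" "b $ 0 \<noteq> 0"
  shows "inv_mat (A_center n a b) \<in> carrier_mat 2 2"
    "A_center n a b * inv_mat (A_center n a b) = 1\<^sub>m 2"
    "inv_mat (A_center n a b) * A_center n a b = 1\<^sub>m 2"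
proof -
  define A where "A = A_center n a b"
  define B where "B = mat_of_rows_list 2
     [[1 / (2 * a $ (n - 1)), 1 / (2 * a $ (n - 1))], [- 1 / (2 * b $ 0), 1 / (2 * b $ 0)]]"
  have A: "A \<in> carrier_mat 2 2" and B: "B \<in> carrier_mat 2 2"
    by (auto simp: A_def B_def A_center_def mat_of_rows_list_def)
  have two: "i = 0 \<or> i = 1" if "i < 2" for i :: nat using that by auto
  have AB: "A * B = 1\<^sub>m 2"
  proof (rule eq_matI)
    fix i j assume "i < dim_row (1\<^sub>m 2 :: real mat)" "j < dim_col (1\<^sub>m 2 :: real mat)"
    hence "i = 0 \<or> i = 1" "j = 0 \<or> j = 1" using two by auto
    thus "(A * B) $$ (i, j) = 1\<^sub>m 2 $$ (i, j)"
      using assms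
      by (auto simp: A_def B_def A_center_def mat_of_rows_list_def scalar_prod_def
          numeral_2_eq_2 field_simps)
  qed (use A B in auto)
  have BA: "B * A = 1\<^sub>m 2"
    using mat_mult_left_right_inverse[OF A B AB] .
  have "A \<in> Units (ring_mat TYPE(real) 2 ())"
    unfolding Units_def ring_mat_def using A B AB BA by auto
  then obtain C where C: "mat_inverse A = Some C"
    using mat_inverse(1)[OF A, of "()"] by (cases "mat_inverse A") auto
  from mat_inverse(2)[OF A C] C
  show "inv_mat (A_center n a b) \<in> carrier_mat 2 2"
    "A_center n a b * inv_mat (A_center n a b) = 1\<^sub>m 2"
    "inv_mat (A_center n a b) * A_center n a b = 1\<^sub>m 2"
    by (auto simp: inv_mat_def A_def)
qed

definition P_tilde :: "nat \<Rightarrow> real vec \<Rightarrow> real vec \<Rightarrow> real mat" where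
  "P_tilde n a b = - (P_cols n a b * inv_mat (A_center n a b))"

definition P_mat :: "nat \<Rightarrow> real vec \<Rightarrow> real vec \<Rightarrow> real vec \<Rightarrow> real vec \<Rightarrow> real mat" where
  "P_mat n u v x y =
     1\<^sub>m (2 * n)
     + (0\<^sub>m (2 * n) (n - 1) @\<^sub>c P_tilde n v x @\<^sub>c 0\<^sub>m (2 * n) (n - 1))
     + (0\<^sub>m (n - 1) (2 * n) @\<^sub>r (P_tilde n y u)\<^sup>T @\<^sub>r 0\<^sub>m (n - 1) (2 * n))"

(* Left eigenvectors are the eigenvectors of the transpose. *)
definition two_sided_eigenvector_mat :: "'a :: comm_ring_1 mat \<Rightarrow> 'a mat \<Rightarrow> bool" where
  "two_sided_eigenvector_mat A P \<longleftrightarrow>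
     P \<in> carrier_mat (dim_row A) (dim_row A) \<and>
     (\<forall>j < dim_col P. \<exists>k. eigenvector A (col P j) k) \<and>
     (\<forall>i < dim_row P. \<exists>k. eigenvector A\<^sup>T (row P i) k)"

end

theory Submission
  imports Defs
begin

text \<open>
  The matrix \<open>M\<close> has rank two. Conjugation by \<open>X_mat n\<close> turns its two off-diagonal rank-one
  blocks into \<open>M = C * S * B\<close>, where the columns of \<open>C = P_cols n v x\<close> and the rows of
  \<open>B = (P_cols n y u)\<^sup>T\<close> are the vectors of the construction and \<open>S\<close> is a multiple of the swap of two
  coordinates (\<open>M_mat_factor\<close>). The two systems are biorthogonal: \<open>B * C\<close> is diagonal with
  entries \<open>2 * (y \<bullet> v)\<close> and \<open>2 * (u \<bullet> x)\<close> (\<open>P_cols_gram\<close>). In the square \<open>M * M\<close> the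
  swaps on both sides of \<open>B * C\<close> exchange these entries, so that each column of \<open>C\<close> is
  multiplied by both pairings (\<open>M_mat_square\<close>). Both nonzero eigenvalues therefore equal
  \<open>lam = (u \<bullet> x) * (y \<bullet> v)\<close>, and \<open>N = M\<^sup>2 / lam\<close> is a projector of rank two: its range is
  spanned by the columns of \<open>C\<close> and its kernel is the common kernel of the rows of \<open>B\<close>.

  Let \<open>E\<close> embed the two-dimensional space onto the two central coordinates. Then
  \<open>E * E\<^sup>T\<close> is the projector onto these coordinates, and \<open>D = lam * E * E\<^sup>T\<close>. The
  tilde matrices \<open>T\<close> and \<open>R\<^sup>T\<close> span the same spaces as \<open>C\<close> and \<open>B\<^sup>T\<close>, but are normalized
  so that their central blocks are minus the identity. With this normalization the matrix
  \<open>P = 1 + T * E\<^sup>T + E * R\<close> satisfies \<open>P * E = T\<close> and \<open>E\<^sup>T * P = R\<close>, and a short computation,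
  valid for any projector in such a position relative to a coordinate projector, shows that
  \<open>P\<close> intertwines \<open>N\<close> with \<open>E * E\<^sup>T\<close> from both sides and is inverted by
  \<open>1 - E * E\<^sup>T - N\<close> (\<open>coordinate_projector_intertwiner\<close>). Scaling by \<open>lam\<close> gives the two
  eigenvalue equations, and invertibility makes the rows and columns of \<open>P\<close> nonzero.
\<close>

section \<open>Intertwining a projector with a coordinate projector\<close>

text \<open>
  Associativity with side conditions on dimensions only. Unlike the version with
  carrier assumptions it has no free dimension parameters, so the simplifier can
  discharge its conditions for arbitrarily nested products.
\<close>
lemma mult_mat_assoc_dim:
  fixes A B C :: "'a :: semiring_0 mat"
  assumes "dim_col A = dim_row B" "dim_col B = dim_row C"
  shows "A * B * C = A * (B * C)"
  by (rule assoc_mult_mat) (use assms in \<open>auto intro!: carrier_matI\<close>)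

text \<open>
  \<open>E * F\<close> projects onto the range of \<open>E\<close> along the kernel of \<open>F\<close>, and \<open>N\<close> projects onto the
  range of \<open>T\<close> along the kernel of \<open>R\<close>; the normalization makes \<open>P\<close> send \<open>E\<close> to \<open>T\<close> and \<open>F\<close>
  to \<open>R\<close> (\<open>P * E = T\<close>, \<open>F * P = R\<close>). Since \<open>N\<close> fixes \<open>T\<close> from the left and \<open>R\<close> from the
  right, both \<open>N * P\<close> and \<open>P * (E * F)\<close> collapse to \<open>T * F\<close>, and both \<open>P * N\<close> and
  \<open>E * F * P\<close> collapse to \<open>E * R\<close>. Subtracting these two corrections from \<open>P\<close> leaves the
  identity, which is the formula for the inverse.
\<close>
lemma coordinate_projector_intertwiner:
  fixes T E F R K :: "'a :: comm_ring_1 mat"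
  assumes T: "T \<in> carrier_mat m k" and E: "E \<in> carrier_mat m k"
    and F: "F \<in> carrier_mat k m" and R: "R \<in> carrier_mat k m" and K: "K \<in> carrier_mat k k"
    and FE: "F * E = 1\<^sub>m k" and FT: "F * T = - 1\<^sub>m k" and RE: "R * E = - 1\<^sub>m k"
    and KRT: "K * (R * T) = 1\<^sub>m k" and RTK: "(R * T) * K = 1\<^sub>m k"
    and N_def: "N = T * K * R" and P_def: "P = 1\<^sub>m m + T * F + E * R"
  shows "N * P = P * (E * F)" "P * N = (E * F) * P"
    "P * (1\<^sub>m m - E * F - N) = 1\<^sub>m m" "(1\<^sub>m m - E * F - N) * P = 1\<^sub>m m"
proof -
  note c = T E F R K
  have car: "T * F \<in> carrier_mat m m" "E * R \<in> carrier_mat m m" "E * F \<in> carrier_mat m m"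
    "N \<in> carrier_mat m m" "P \<in> carrier_mat m m" "T * K \<in> carrier_mat m k" "R * T \<in> carrier_mat k k"
    using c by (auto simp: N_def P_def)
  have NT: "N * T = T"
  proof -
    have "N * T = T * (K * (R * T))" unfolding N_def using c car by (simp add: mult_mat_assoc_dim)
    thus ?thesis using c by (simp add: KRT)
  qed
  have RN: "R * N = R"
  proof -
    have "R * N = ((R * T) * K) * R" unfolding N_def using c car by (simp add: mult_mat_assoc_dim)
    thus ?thesis using c by (simp add: RTK)
  qed
  have NE: "N * E = - (T * K)"
  proof -
    have "N * E = T * K * (R * E)" unfolding N_def by (rule assoc_mult_mat, use c car in auto)
    thus ?thesis using c car by (simp add: RE)
  qed
  have FN: "F * N = - (K * R)"
  proof -
    have "F * N = (F * T) * (K * R)" unfolding N_def using c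
      by (simp add: mult_mat_assoc_dim)
    thus ?thesis using c by (simp add: FT)
  qed
  have PE: "P * E = T"
  proof -
    have "P * E = E + T * (F * E) + E * (R * E)" unfolding P_def using c car
      by (simp add: add_mult_distrib_mat[of _ m m] mult_mat_assoc_dim)
    also have "\<dots> = T" using c by (intro eq_matI) (auto simp: FE RE)
    finally show ?thesis .
  qed
  have FP: "F * P = R"
  proof -
    have "F * P = F + (F * T) * F + (F * E) * R" unfolding P_def using c car
      by (simp add: mult_add_distrib_mat[of F k m _ m] mult_mat_assoc_dim)
    also have "\<dots> = R" using c by (intro eq_matI) (auto simp: FE FT)
    finally show ?thesis .
  qed
  have P_EF: "P * (E * F) = T * F"
    using c car PE assoc_mult_mat[of P m m E k F m] by simp
  have EF_P: "(E * F) * P = E * R"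
    using c car FP assoc_mult_mat[of E m k F m P m] by simp
  have NER: "(N * E) * R = - N" unfolding NE unfolding N_def using c car by simp
  have TFN: "T * (F * N) = - N" unfolding FN unfolding N_def using c by (simp add: mult_mat_assoc_dim)
  have "N * P = N + (N * T) * F + (N * E) * R" unfolding P_def using c car
    by (simp add: mult_add_distrib_mat[of N m m _ m] mult_mat_assoc_dim)
  also have "\<dots> = T * F"
    unfolding NT NER using c car(1,4) by (intro eq_matI) (auto simp del: index_mult_mat(1))
  finally have NP: "N * P = T * F" .
  have "P * N = N + T * (F * N) + E * (R * N)" unfolding P_def using c car
    by (simp add: add_mult_distrib_mat[of _ m m] mult_mat_assoc_dim)
  also have "\<dots> = E * R"
    unfolding RN TFN using c car(2,4) by (intro eq_matI) (auto simp del: index_mult_mat(1))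
  finally have PN: "P * N = E * R" .
  show "N * P = P * (E * F)" "P * N = (E * F) * P" using NP P_EF PN EF_P by auto
  have "P * (1\<^sub>m m - E * F - N) = P - P * (E * F) - P * N"
    using mult_minus_distrib_mat[OF car(5) minus_carrier_mat[OF car(3)] car(4), of "1\<^sub>m m"]
      mult_minus_distrib_mat[OF car(5) one_carrier_mat car(3)] car by simp
  also have "\<dots> = 1\<^sub>m m" unfolding P_EF PN using c car by (intro eq_matI) (auto simp: P_def)
  finally show "P * (1\<^sub>m m - E * F - N) = 1\<^sub>m m" .
  have "(1\<^sub>m m - E * F - N) * P = P - (E * F) * P - N * P"
    using minus_mult_distrib_mat[OF minus_carrier_mat[OF car(3)] car(4,5), of "1\<^sub>m m"]
      minus_mult_distrib_mat[OF one_carrier_mat car(3,5)] car by simp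
  also have "\<dots> = 1\<^sub>m m" unfolding EF_P NP using c car by (intro eq_matI) (auto simp: P_def)
  finally show "(1\<^sub>m m - E * F - N) * P = 1\<^sub>m m" .
qed

section \<open>From matrix equations to two-sided eigenvectors\<close>

text \<open>
  The invertibility of \<open>P\<close> is what makes its columns nonzero, hence eigenvectors.
\<close>
lemma eigenvector_col:
  fixes A P Q :: "'a :: field mat"
  assumes A: "A \<in> carrier_mat m m" and P: "P \<in> carrier_mat m m" and Q: "Q \<in> carrier_mat m m"
    and QP: "Q * P = 1\<^sub>m m" and AP: "A * P = P * mat_diag m d" and j: "j < m"
  shows "eigenvector A (col P j) (d j)"
proof -
  have "A *\<^sub>v col P j = col (A * P) j"
    using A P j by (intro eq_vecI) auto
  also have "\<dots> = d j \<cdot>\<^sub>v col P j"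
    unfolding AP mat_diag_mult_right[OF P] using P j by (intro eq_vecI) auto
  finally have "A *\<^sub>v col P j = d j \<cdot>\<^sub>v col P j" .
  moreover have "col P j \<noteq> 0\<^sub>v m"
  proof
    assume "col P j = 0\<^sub>v m"
    hence "(Q * P) $$ (j, j) = 0" using P Q j by simp
    thus False using QP j by simp
  qed
  ultimately show ?thesis using A P j by (auto simp: eigenvector_def)
qed

lemma two_sided_eigenvector_matI:
  fixes A P Q :: "'a :: field mat"
  assumes A: "A \<in> carrier_mat m m" and P: "P \<in> carrier_mat m m" and Q: "Q \<in> carrier_mat m m"
    and PQ: "P * Q = 1\<^sub>m m" and QP: "Q * P = 1\<^sub>m m"
    and AP: "A * P = P * mat_diag m d" and PA: "P * A = mat_diag m d * P"
  shows "two_sided_eigenvector_mat A P"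
proof -
  have D: "(mat_diag m d)\<^sup>T = mat_diag m d" by (auto simp: mat_diag_def)
  have "eigenvector A\<^sup>T (col P\<^sup>T i) (d i)" if "i < m" for i
  proof (rule eigenvector_col[OF _ _ _ _ _ that])
    show "Q\<^sup>T * P\<^sup>T = 1\<^sub>m m"
      using PQ transpose_mult[OF P Q] by simp
    show "A\<^sup>T * P\<^sup>T = P\<^sup>T * mat_diag m d"
      using arg_cong[OF PA, of transpose_mat] transpose_mult[OF P A]
        transpose_mult[OF mat_diag_dim P] D by simp
  qed (use A P Q in auto)
  thus ?thesis using A P eigenvector_col[OF A P Q QP AP]
    by (auto simp: two_sided_eigenvector_mat_def)
qed

section \<open>The flip and the orthogonal change of basis\<close>

lemma J_mat_carrier [simp]: "J_mat n \<in> carrier_mat n n"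
  by (simp add: J_mat_def)

lemma dim_J_mat [simp]: "dim_row (J_mat n) = n" "dim_col (J_mat n) = n"
  by (simp_all add: J_mat_def)

lemma J_mat_mult_vec:
  assumes "w \<in> carrier_vec n"
  shows "J_mat n *\<^sub>v w = vec n (\<lambda>i. w $ (n - 1 - i))"
proof (rule eq_vecI)
  fix i assume "i < dim_vec (vec n (\<lambda>i. w $ (n - 1 - i)))"
  hence i: "i < n" by simp
  have "(J_mat n *\<^sub>v w) $ i = (\<Sum>j = 0..<n. (if i + j + 1 = n then 1 else 0) * w $ j)"
    using assms i by (simp add: J_mat_def scalar_prod_def)
  also have "\<dots> = (\<Sum>j = 0..<n. if j = n - 1 - i then w $ j else 0)"
    using i by (intro sum.cong) auto
  also have "\<dots> = w $ (n - 1 - i)"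
    using i by simp
  finally show "(J_mat n *\<^sub>v w) $ i = vec n (\<lambda>i. w $ (n - 1 - i)) $ i"
    using i by simp
qed (simp add: J_mat_def)

lemma J_mat_mult_vec_carrier [simp]: "J_mat n *\<^sub>v w \<in> carrier_vec n"
  by (simp add: J_mat_def carrier_vecI)

lemma J_mat_mult_vec_involutive:
  assumes "w \<in> carrier_vec n"
  shows "J_mat n *\<^sub>v (J_mat n *\<^sub>v w) = w"
  using assms by (intro eq_vecI) (auto simp: J_mat_mult_vec)

lemma scalar_prod_J_mat:
  assumes a: "a \<in> carrier_vec n" and b: "b \<in> carrier_vec n"
  shows "(J_mat n *\<^sub>v a) \<bullet> b = a \<bullet> (J_mat n *\<^sub>v b)"
proof -
  have rev: "(\<Sum>i = 0..<n. f i) = (\<Sum>i = 0..<n. f (n - 1 - i))" for f :: "nat \<Rightarrow> real"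
    using sum.nat_diff_reindex[of f n] by (simp add: atLeast0LessThan)
  have "(J_mat n *\<^sub>v a) \<bullet> b = (\<Sum>i = 0..<n. a $ (n - 1 - i) * b $ i)"
    using b by (simp add: scalar_prod_def J_mat_mult_vec[OF a])
  also have "\<dots> = (\<Sum>i = 0..<n. a $ i * b $ (n - 1 - i))"
    by (subst rev) (auto intro!: sum.cong)
  also have "\<dots> = a \<bullet> (J_mat n *\<^sub>v b)"
    by (simp add: scalar_prod_def J_mat_mult_vec[OF b])
  finally show "(J_mat n *\<^sub>v a) \<bullet> b = a \<bullet> (J_mat n *\<^sub>v b)" .
qed

lemma X_mat_carrier [simp]: "X_mat n \<in> carrier_mat (2 * n) (2 * n)"
  by (auto simp: X_mat_def mult_2 J_mat_def)

lemma X_mat_transpose: "(X_mat n)\<^sup>T = X_mat n"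
  by (intro eq_matI) (auto simp: X_mat_def J_mat_def)

lemma P_cols_carrier [simp]: "P_cols n a b \<in> carrier_mat (2 * n) 2"
  by (rule carrier_matI) (simp_all add: P_cols_def)

text \<open>
  The sign on \<open>b\<close> is chosen so that the change of basis takes these columns exactly to
  \<open>P_cols n a b\<close>, up to the factor \<open>1 / sqrt 2\<close>.
\<close>
definition block_cols :: "nat \<Rightarrow> real vec \<Rightarrow> real vec \<Rightarrow> real mat" where
  "block_cols n a b = mat_of_cols (2 * n) [a @\<^sub>v 0\<^sub>v n, 0\<^sub>v n @\<^sub>v (- b)]"

lemma block_cols_carrier [simp]: "block_cols n a b \<in> carrier_mat (2 * n) 2"
  by (rule carrier_matI) (simp_all add: block_cols_def)

lemma X_mat_mult_append_vec:
  assumes a: "a \<in> carrier_vec n" and b: "b \<in> carrier_vec n"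
  shows "X_mat n *\<^sub>v (a @\<^sub>v b)
    = (1 / sqrt 2) \<cdot>\<^sub>v ((a + J_mat n *\<^sub>v b) @\<^sub>v (J_mat n *\<^sub>v a - b))"
proof -
  have "four_block_mat (1\<^sub>m n) (J_mat n) (J_mat n) (- 1\<^sub>m n) *\<^sub>v (a @\<^sub>v b)
    = (1\<^sub>m n *\<^sub>v a + J_mat n *\<^sub>v b) @\<^sub>v (J_mat n *\<^sub>v a + (- 1\<^sub>m n) *\<^sub>v b)"
    by (rule four_block_mat_mult_vec) (use a b in auto)
  also have "(- 1\<^sub>m n) *\<^sub>v b = - b"
    using b by simp
  also have "J_mat n *\<^sub>v a + - b = J_mat n *\<^sub>v a - b"
    using a b by (intro eq_vecI) auto
  finally have block: "four_block_mat (1\<^sub>m n) (J_mat n) (J_mat n) (- 1\<^sub>m n) *\<^sub>v (a @\<^sub>v b)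
    = (a + J_mat n *\<^sub>v b) @\<^sub>v (J_mat n *\<^sub>v a - b)"
    using a by simp
  have smult: "(c \<cdot>\<^sub>m A) *\<^sub>v w = c \<cdot>\<^sub>v (A *\<^sub>v w)" if "dim_vec w = dim_col A" for c :: real and A w
    using that by (intro eq_vecI) (auto simp: scalar_prod_def sum_distrib_left mult.assoc)
  show ?thesis
    unfolding X_mat_def block[symmetric] by (rule smult) (use a b in simp)
qed

lemma X_mat_mult_block_cols:
  assumes a: "a \<in> carrier_vec n" and b: "b \<in> carrier_vec n"
  shows "X_mat n * block_cols n a b = (1 / sqrt 2) \<cdot>\<^sub>m P_cols n a b"
proof (rule eq_matI)
  fix i j assume ij: "i < dim_row ((1 / sqrt 2) \<cdot>\<^sub>m P_cols n a b)"
    "j < dim_col ((1 / sqrt 2) \<cdot>\<^sub>m P_cols n a b)"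
  hence i: "i < 2 * n" and j: "j = 0 \<or> j = 1" by (auto simp: P_cols_def)
  have c0: "col (block_cols n a b) 0 = a @\<^sub>v 0\<^sub>v n" and c1: "col (block_cols n a b) (Suc 0) = 0\<^sub>v n @\<^sub>v (- b)"
    using a b by (auto simp: block_cols_def mult_2)
  have J0: "J_mat n *\<^sub>v 0\<^sub>v n = 0\<^sub>v n" and Jb: "J_mat n *\<^sub>v (- b) = - (J_mat n *\<^sub>v b)"
    using b by (intro eq_vecI; simp add: J_mat_def scalar_prod_def sum_negf)+
  have "(X_mat n * block_cols n a b) $$ (i, j) = (X_mat n *\<^sub>v col (block_cols n a b) j) $ i"
    using i j by (auto simp: block_cols_def X_mat_def)
  also have "\<dots> = ((1 / sqrt 2) \<cdot>\<^sub>m P_cols n a b) $$ (i, j)"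
    using i j a b X_mat_mult_append_vec[OF a zero_carrier_vec] X_mat_mult_append_vec[OF zero_carrier_vec, of "- b" n]
    by (auto simp: c0 c1 J0 Jb P_cols_def mat_of_cols_index simp del: index_mult_mat_vec)
  finally show "(X_mat n * block_cols n a b) $$ (i, j) = ((1 / sqrt 2) \<cdot>\<^sub>m P_cols n a b) $$ (i, j)" .
qed (auto simp: P_cols_def block_cols_def X_mat_def)

section \<open>Factoring the matrix through two dimensions\<close>

lemma outer_prod_index:
  assumes "i < dim_vec v" "j < dim_vec w"
  shows "outer_prod v w $$ (i, j) = v $ i * w $ j"
  using assms by (simp add: outer_prod_def mat_of_row_def scalar_prod_def mat_of_cols_index)

lemma dim_outer_prod [simp]: "dim_row (outer_prod v w) = dim_vec v" "dim_col (outer_prod v w) = dim_vec w"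
  by (auto simp: outer_prod_def mat_of_row_def)

definition neg_swap :: "real mat" where
  "neg_swap = mat 2 2 (\<lambda>(i,j). if i = j then 0 else - 1)"

lemma neg_swap_carrier [simp]: "neg_swap \<in> carrier_mat 2 2"
  by (simp add: neg_swap_def)

text \<open>
  The off-diagonal blocks have rank one each, so two columns and two rows suffice; the sign in
  \<open>neg_swap\<close> cancels the one in \<open>block_cols\<close>.
\<close>
lemma off_diagonal_blocks_factor:
  assumes "u \<in> carrier_vec n" "v \<in> carrier_vec n" "x \<in> carrier_vec n" "y \<in> carrier_vec n"
  shows "four_block_mat (0\<^sub>m n n) (outer_prod v u) (outer_prod x y) (0\<^sub>m n n)
    = block_cols n v x * neg_swap * (block_cols n y u)\<^sup>T"
  using assms
  by (intro eq_matI) (auto simp: block_cols_def neg_swap_def outer_prod_index mat_of_cols_index scalar_prod_def numeral_2_eq_2)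

lemma M_mat_factor:
  assumes "u \<in> carrier_vec n" "v \<in> carrier_vec n" "x \<in> carrier_vec n" "y \<in> carrier_vec n"
  shows "M_mat n u v x y = P_cols n v x * ((1 / 2) \<cdot>\<^sub>m neg_swap) * (P_cols n y u)\<^sup>T"
proof -
  let ?L = "block_cols n v x" and ?R = "block_cols n y u" and ?X = "X_mat n"
  have assoc: "A * (B * C * D) * F = A * B * C * (D * F)"
    if "A \<in> carrier_mat (2 * n) (2 * n)" "B \<in> carrier_mat (2 * n) 2" "C \<in> carrier_mat 2 2"
      "D \<in> carrier_mat 2 (2 * n)" "F \<in> carrier_mat (2 * n) (2 * n)" for A B C D F :: "real mat"
    using that by (simp add: mult_mat_assoc_dim)
  have "M_mat n u v x y = ?X * (?L * neg_swap * ?R\<^sup>T) * ?X\<^sup>T"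
    unfolding M_mat_def X_mat_transpose using off_diagonal_blocks_factor[OF assms] by simp
  also have "\<dots> = ?X * ?L * neg_swap * (?R\<^sup>T * ?X\<^sup>T)"
    by (rule assoc) auto
  also have "?R\<^sup>T * ?X\<^sup>T = (?X * ?R)\<^sup>T"
    by (rule transpose_mult[OF X_mat_carrier block_cols_carrier, symmetric])
  also have "?X * ?L * neg_swap * (?X * ?R)\<^sup>T
      = ((1 / sqrt 2) \<cdot>\<^sub>m P_cols n v x) * neg_swap * ((1 / sqrt 2) \<cdot>\<^sub>m P_cols n y u)\<^sup>T"
    using assms by (simp add: X_mat_mult_block_cols)
  also have "\<dots> = P_cols n v x * ((1 / 2) \<cdot>\<^sub>m neg_swap) * (P_cols n y u)\<^sup>T"
    by (intro eq_matI) (auto simp: P_cols_def neg_swap_def mat_of_cols_index scalar_prod_def numeral_2_eq_2 field_simps)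
  finally show ?thesis .
qed

text \<open>
  The mixed entries vanish because the flip is symmetric, and the diagonal entries double
  because it is an involution.
\<close>
lemma P_cols_gram:
  assumes "u \<in> carrier_vec n" "v \<in> carrier_vec n" "x \<in> carrier_vec n" "y \<in> carrier_vec n"
  shows "(P_cols n y u)\<^sup>T * P_cols n v x
    = mat_diag 2 (\<lambda>i. if i = 0 then 2 * (y \<bullet> v) else 2 * (u \<bullet> x))"
proof -
  note sp = scalar_prod_append[of _ n _ n]
  show ?thesis
    using assms
    by (intro eq_matI) (auto simp: P_cols_def mat_diag_def col_mat_of_cols sp less_Suc_eq numeral_2_eq_2
        scalar_prod_J_mat J_mat_mult_vec_involutive)
qed

text \<open>
  Squaring puts the diagonal Gram matrix between two scaled swaps, which exchanges its
  diagonal entries up to the factor \<open>1 / 4\<close>. Multiplied by the Gram matrix once more, the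
  result has both diagonal entries equal to \<open>(u \<bullet> x) * (y \<bullet> v)\<close>, which is why the square has a double eigenvalue.
\<close>
lemma M_mat_square:
  assumes "u \<in> carrier_vec n" "v \<in> carrier_vec n" "x \<in> carrier_vec n" "y \<in> carrier_vec n"
  shows "M_mat n u v x y ^\<^sub>m 2
    = P_cols n v x * mat_diag 2 (\<lambda>i. if i = 0 then u \<bullet> x / 2 else y \<bullet> v / 2) * (P_cols n y u)\<^sup>T"
proof -
  let ?C = "P_cols n v x" and ?B = "(P_cols n y u)\<^sup>T" and ?H = "(1 / 2 :: real) \<cdot>\<^sub>m neg_swap"
  have assoc: "(C * H * B) * (C * H * B) = C * (H * (B * C) * H) * B"
    if "C \<in> carrier_mat (2 * n) 2" "H \<in> carrier_mat 2 2" "B \<in> carrier_mat 2 (2 * n)" for B C H :: "real mat"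
    using that by (simp add: mult_mat_assoc_dim)
  have M: "M_mat n u v x y = ?C * ?H * ?B"
    by (rule M_mat_factor[OF assms])
  have "M_mat n u v x y ^\<^sub>m 2 = M_mat n u v x y * M_mat n u v x y"
    by (simp add: numeral_2_eq_2 M_mat_def)
  also have "\<dots> = (?C * ?H * ?B) * (?C * ?H * ?B)"
    unfolding M ..
  also have "\<dots> = ?C * (?H * (?B * ?C) * ?H) * ?B"
    by (rule assoc) auto
  also have "?H * (?B * ?C) * ?H = mat_diag 2 (\<lambda>i. if i = 0 then u \<bullet> x / 2 else y \<bullet> v / 2)"
    unfolding P_cols_gram[OF assms]
    by (intro eq_matI) (auto simp: neg_swap_def mat_diag_def scalar_prod_def numeral_2_eq_2 less_Suc_eq)
  finally show ?thesis .
qed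

section \<open>The two central coordinates\<close>

text \<open>
  The embedding of the two-dimensional space onto the central coordinates, numbered
  \<open>n - 1\<close> and \<open>n\<close>; the condition is written additively so that no truncated subtraction occurs.
\<close>
definition center_embed :: "nat \<Rightarrow> real mat" where
  "center_embed n = mat (2 * n) 2 (\<lambda>(i,j). if i + 1 = n + j then 1 else 0)"

lemma center_embed_carrier [simp]: "center_embed n \<in> carrier_mat (2 * n) 2"
  by (simp add: center_embed_def)

lemma mult_center_embed_transpose:
  assumes "n \<ge> 1" and T: "T \<in> carrier_mat (2 * n) 2"
  shows "0\<^sub>m (2 * n) (n - 1) @\<^sub>c T @\<^sub>c 0\<^sub>m (2 * n) (n - 1) = T * (center_embed n)\<^sup>T"
proof -
  obtain p where n: "n = Suc p" using assms(1) by (cases n) auto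
  have dim: "dim_row T = 2 * n" "dim_col T = 2" using T by auto
  show ?thesis
    using dim unfolding n
    by (intro eq_matI) (auto simp: append_cols_def center_embed_def scalar_prod_def numeral_2_eq_2
        not_less less_Suc_eq, auto)
qed

lemma center_embed_mult:
  assumes "n \<ge> 1" and R: "R \<in> carrier_mat 2 (2 * n)"
  shows "0\<^sub>m (n - 1) (2 * n) @\<^sub>r R @\<^sub>r 0\<^sub>m (n - 1) (2 * n) = center_embed n * R"
proof -
  obtain p where n: "n = Suc p" using assms(1) by (cases n) auto
  have dim: "dim_row R = 2" "dim_col R = 2 * n" using R by auto
  show ?thesis
    using dim unfolding n
    by (intro eq_matI) (auto simp: append_rows_def center_embed_def scalar_prod_def numeral_2_eq_2
        not_less less_Suc_eq, auto)
qed

lemma center_embed_transpose_mult: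
  assumes "n \<ge> 1" and C: "C \<in> carrier_mat (2 * n) c"
  shows "(center_embed n)\<^sup>T * C = mat 2 c (\<lambda>(i,j). C $$ (n - 1 + i, j))"
proof (rule eq_matI)
  fix i j assume "i < dim_row (mat 2 c (\<lambda>(i,j). C $$ (n - 1 + i, j)))"
    "j < dim_col (mat 2 c (\<lambda>(i,j). C $$ (n - 1 + i, j)))"
  hence ij: "i < 2" "j < c" by auto
  have "((center_embed n)\<^sup>T * C) $$ (i, j)
      = (\<Sum>k = 0..<2 * n. (if k + 1 = n + i then 1 else 0) * C $$ (k, j))"
    using ij C by (auto simp: center_embed_def scalar_prod_def intro!: sum.cong)
  also have "\<dots> = (\<Sum>k = 0..<2 * n. if k = n - 1 + i then C $$ (k, j) else 0)"
    using assms(1) by (intro sum.cong) auto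
  also have "\<dots> = C $$ (n - 1 + i, j)"
    using assms(1) ij by simp
  finally show "((center_embed n)\<^sup>T * C) $$ (i, j) = mat 2 c (\<lambda>(i,j). C $$ (n - 1 + i, j)) $$ (i, j)"
    using ij by simp
qed (use C in \<open>auto simp: center_embed_def\<close>)

lemma center_embed_transpose_mult_P_cols:
  assumes n: "n \<ge> 1" and "a \<in> carrier_vec n" "b \<in> carrier_vec n"
  shows "(center_embed n)\<^sup>T * P_cols n a b = A_center n a b"
  unfolding center_embed_transpose_mult[OF n P_cols_carrier] A_center_central_rows[OF assms]
  using n by (intro eq_matI) (auto simp: P_cols_def mat_of_rows_index numeral_2_eq_2 less_Suc_eq)

lemma center_embed_orthonormal:
  assumes n: "n \<ge> 1"
  shows "(center_embed n)\<^sup>T * center_embed n = 1\<^sub>m 2"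
  unfolding center_embed_transpose_mult[OF n center_embed_carrier]
  using n by (intro eq_matI) (auto simp: center_embed_def)

lemma central_projector:
  "diag_of_vec (0\<^sub>v (n - 1) @\<^sub>v (c \<cdot>\<^sub>v ones_vec 2) @\<^sub>v 0\<^sub>v (n - 1))
    = c \<cdot>\<^sub>m (center_embed n * (center_embed n)\<^sup>T)"
   "diag_of_vec (ones_vec (n - 1) @\<^sub>v 0\<^sub>v 2 @\<^sub>v ones_vec (n - 1)) 
    = 1\<^sub>m (2 * n) - center_embed n * (center_embed n)\<^sup>T"
  if "n \<ge> 1"
  using that
  by (intro eq_matI; auto simp: diag_of_vec_def mat_diag_def ones_vec_def center_embed_def
      scalar_prod_def numeral_2_eq_2)+

text \<open>
  Dividing by the central block normalizes the columns so that their central rows form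
  \<open>- 1\<^sub>m 2\<close>, without changing their span.
\<close>
lemma P_tilde_properties:
  assumes n: "n \<ge> 1" and a: "a \<in> carrier_vec n" and b: "b \<in> carrier_vec n"
    and nz: "a $ (n - 1) \<noteq> 0" "b $ 0 \<noteq> 0"
  shows P_tilde_carrier: "P_tilde n a b \<in> carrier_mat (2 * n) 2"
    and P_cols_eq_P_tilde: "P_cols n a b = P_tilde n a b * (- A_center n a b)"
    and center_P_tilde: "(center_embed n)\<^sup>T * P_tilde n a b = - 1\<^sub>m 2"
proof -
  let ?C = "P_cols n a b" and ?A = "A_center n a b" and ?S = "inv_mat (A_center n a b)"
  note S = inv_mat_A_center[OF nz]
  have A: "?A \<in> carrier_mat 2 2"
    using center_embed_transpose_mult_P_cols[OF n a b, symmetric] by (simp add: center_embed_def P_cols_def carrier_matI)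
  show "P_tilde n a b \<in> carrier_mat (2 * n) 2"
    using mult_carrier_mat[OF P_cols_carrier S(1)] by (simp add: P_tilde_def)
  have "?C * ?S * ?A = ?C"
    using assoc_mult_mat[OF P_cols_carrier S(1) A] S(3) right_mult_one_mat[OF P_cols_carrier] by simp
  thus "?C = P_tilde n a b * (- ?A)"
    using S(1) A by (simp add: P_tilde_def)
  have "(center_embed n)\<^sup>T * (?C * ?S) = ?A * ?S"
    using assoc_mult_mat[of "(center_embed n)\<^sup>T" 2 "2 * n" ?C 2 ?S 2] S(1)
      center_embed_transpose_mult_P_cols[OF n a b] by simp
  moreover have "(center_embed n)\<^sup>T * - (?C * ?S) = - ((center_embed n)\<^sup>T * (?C * ?S))"
    by (rule uminus_mult_right_mat) (simp add: center_embed_def P_cols_def)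
  ultimately show "(center_embed n)\<^sup>T * P_tilde n a b = - 1\<^sub>m 2"
    unfolding P_tilde_def using S(2) by metis
qed

section \<open>The eigenvector matrix\<close>

theorem theorem12:
  fixes n :: nat and u v x y :: "real vec" and lam :: real
  assumes "n \<ge> 1"
    and "u \<in> carrier_vec n" "v \<in> carrier_vec n" "x \<in> carrier_vec n" "y \<in> carrier_vec n"
    and "lam = (u \<bullet> x) * (y \<bullet> v)" "lam \<noteq> 0"
    and "u $ 0 \<noteq> 0" "v $ (n - 1) \<noteq> 0" "x $ 0 \<noteq> 0" "y $ (n - 1) \<noteq> 0"
    and "M = M_mat n u v x y"
    and "P = P_mat n u v x y"
    and "D = diag_of_vec (0\<^sub>v (n - 1) @\<^sub>v (lam \<cdot>\<^sub>v ones_vec 2) @\<^sub>v 0\<^sub>v (n - 1))"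
    and "Q = diag_of_vec (ones_vec (n - 1) @\<^sub>v 0\<^sub>v 2 @\<^sub>v ones_vec (n - 1)) - (1 / lam) \<cdot>\<^sub>m (M ^\<^sub>m 2)"
  shows "two_sided_eigenvector_mat (M ^\<^sub>m 2) P
    \<and> (M ^\<^sub>m 2) * P = P * D
    \<and> P * (M ^\<^sub>m 2) = D * P
    \<and> inverts_mat P Q \<and> inverts_mat Q P"
proof -
  note n = assms(1) and u = assms(2) and v = assms(3) and x = assms(4) and y = assms(5)
  note lam = assms(6,7)
  note nz1 = assms(9,10) and nz2 = assms(11,8)
  define E where "E = center_embed n"
  \<comment> \<open>\<open>A1\<close> and \<open>A2\<close> carry the minus sign of \<open>P_tilde\<close>, so that \<open>C = T * A1\<close> and
     \<open>B = A2\<^sup>T * R\<close> hold without signs.\<close>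
  define A1 where "A1 = - A_center n v x"
  define A2 where "A2 = - A_center n y u"
  define T where "T = P_tilde n v x"
  define R where "R = (P_tilde n y u)\<^sup>T"
  define C where "C = P_cols n v x"
  define B where "B = (P_cols n y u)\<^sup>T"
  define V where "V = mat_diag 2 (\<lambda>i. if i = 0 then u \<bullet> x / 2 else y \<bullet> v / 2)"
  define W where "W = (1 / lam) \<cdot>\<^sub>m V"
  \<comment> \<open>The inverse of \<open>R * T\<close>, found by writing \<open>C * W * B\<close> in terms of \<open>T\<close> and \<open>R\<close>.\<close>
  define K where "K = A1 * W * A2\<^sup>T"
  define N where "N = (1 / lam) \<cdot>\<^sub>m (M ^\<^sub>m 2)"
  have E: "E \<in> carrier_mat (2 * n) 2" and F: "E\<^sup>T \<in> carrier_mat 2 (2 * n)"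
    by (auto simp: E_def)
  have A1: "A1 \<in> carrier_mat 2 2" and A2: "A2 \<in> carrier_mat 2 2"
    by (auto simp: A1_def A2_def A_center_def mat_of_rows_list_def)
  have T: "T \<in> carrier_mat (2 * n) 2"
    unfolding T_def by (rule P_tilde_carrier[OF n v x nz1])
  have Pt: "P_tilde n y u \<in> carrier_mat (2 * n) 2"
    by (rule P_tilde_carrier[OF n y u nz2])
  hence R: "R \<in> carrier_mat 2 (2 * n)"
    by (simp add: R_def)
  have C: "C \<in> carrier_mat (2 * n) 2" and B: "B \<in> carrier_mat 2 (2 * n)"
    by (auto simp: C_def B_def)
  have V: "V \<in> carrier_mat 2 2" and W: "W \<in> carrier_mat 2 2"
    by (auto simp: V_def W_def)
  have K: "K \<in> carrier_mat 2 2"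
    using A1 A2 W by (auto simp: K_def)
  have RT: "R * T \<in> carrier_mat 2 2"
    using R T by auto
  have FE: "E\<^sup>T * E = 1\<^sub>m 2"
    unfolding E_def by (rule center_embed_orthonormal[OF n])
  have FT: "E\<^sup>T * T = - 1\<^sub>m 2"
    unfolding E_def T_def by (rule center_P_tilde[OF n v x nz1])
  have "R * E = (E\<^sup>T * P_tilde n y u)\<^sup>T"
    using transpose_mult[OF F Pt] by (simp add: R_def)
  also have "\<dots> = - 1\<^sub>m 2"
    unfolding E_def center_P_tilde[OF n y u nz2] by (intro eq_matI) auto
  finally have RE: "R * E = - 1\<^sub>m 2" .
  have C_T: "C = T * A1"
    unfolding C_def T_def A1_def by (rule P_cols_eq_P_tilde[OF n v x nz1])
  have B_R: "B = A2\<^sup>T * R"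
    using arg_cong[OF P_cols_eq_P_tilde[OF n y u nz2], of transpose_mat] transpose_mult[OF Pt A2]
    by (simp add: B_def R_def A2_def)
  have M2: "M ^\<^sub>m 2 = C * V * B"
    unfolding assms(12) C_def V_def B_def by (rule M_mat_square[OF u v x y])
  have M2_car: "M ^\<^sub>m 2 \<in> carrier_mat (2 * n) (2 * n)"
    unfolding M2 using C V B by auto
  have "N = C * W * B"
    unfolding N_def M2 W_def using C V B
    by (simp add: mult_smult_distrib[of C "2 * n" 2 V 2] mult_smult_assoc_mat[of "C * V" "2 * n" 2 B "2 * n"])
  also have "\<dots> = T * K * R"
    unfolding C_T B_R K_def using T A1 W A2 R
    by (simp add: mult_mat_assoc_dim)
  finally have N: "N = T * K * R" .
  \<comment> \<open>Each diagonal entry of \<open>W\<close> times the matching Gram entry is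
     \<open>(u \<bullet> x) * (y \<bullet> v) / lam = 1\<close>.\<close>
  have WG: "W * (B * C) = 1\<^sub>m 2"
    unfolding B_def C_def P_cols_gram[OF u v x y] using lam
    by (intro eq_matI) (auto simp: W_def V_def mat_diag_def scalar_prod_def numeral_2_eq_2 less_Suc_eq)
  have BC: "B * C = A2\<^sup>T * (R * T) * A1"
    unfolding C_T B_R using T A1 A2 R
    by (simp add: mult_mat_assoc_dim)
  have "W * (A2\<^sup>T * (R * T)) * A1 = 1\<^sub>m 2"
    using WG unfolding BC using W A1 A2 R T
    by (simp add: mult_mat_assoc_dim)
  \<comment> \<open>Square one-sided inverses are two-sided, which lets \<open>A1\<close> move to the front.\<close>
  hence "A1 * (W * (A2\<^sup>T * (R * T))) = 1\<^sub>m 2"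
    using mat_mult_left_right_inverse[OF mult_carrier_mat[OF W mult_carrier_mat[OF _ RT]] A1] A2 by simp
  hence KRT: "K * (R * T) = 1\<^sub>m 2"
    unfolding K_def using A1 A2 W R T
    by (simp add: mult_mat_assoc_dim)
  have RTK: "R * T * K = 1\<^sub>m 2"
    by (rule mat_mult_left_right_inverse[OF K RT KRT])
  have P: "P = 1\<^sub>m (2 * n) + T * E\<^sup>T + E * R"
    unfolding assms(13) P_mat_def T_def R_def E_def
    using mult_center_embed_transpose[OF n P_tilde_carrier[OF n v x nz1]]
      center_embed_mult[OF n R[unfolded R_def]] by simp
  have P_car: "P \<in> carrier_mat (2 * n) (2 * n)"
    unfolding P using T F E R by auto
  note main = coordinate_projector_intertwiner[OF T E F R K FE FT RE KRT RTK N P]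
  have D: "D = lam \<cdot>\<^sub>m (E * E\<^sup>T)"
    unfolding assms(14) E_def by (rule central_projector(1)[OF n])
  have Q: "Q = 1\<^sub>m (2 * n) - E * E\<^sup>T - N"
    unfolding assms(15) E_def N_def central_projector(2)[OF n] by (rule refl)
  have Q_car: "Q \<in> carrier_mat (2 * n) (2 * n)"
    unfolding Q N_def by (rule minus_carrier_mat) (use M2_car in simp)
  have N_car: "N \<in> carrier_mat (2 * n) (2 * n)" and EF: "E * E\<^sup>T \<in> carrier_mat (2 * n) (2 * n)"
    unfolding N_def using M2_car E F by auto
  have M2_N: "M ^\<^sub>m 2 = lam \<cdot>\<^sub>m N"
    unfolding N_def using lam(2) by (intro eq_matI) auto
  have MP: "M ^\<^sub>m 2 * P = P * D"
    unfolding M2_N D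
    using mult_smult_assoc_mat[OF N_car P_car] mult_smult_distrib[OF P_car EF] main(1) by metis
  have PM: "P * M ^\<^sub>m 2 = D * P"
    unfolding M2_N D
    using mult_smult_assoc_mat[OF EF P_car] mult_smult_distrib[OF P_car N_car] main(2) by metis
  have PQ: "P * Q = 1\<^sub>m (2 * n)" and QP: "Q * P = 1\<^sub>m (2 * n)"
    unfolding Q by (fact main(3), fact main(4))
  have "dim_vec (0\<^sub>v (n - 1) @\<^sub>v (lam \<cdot>\<^sub>v ones_vec 2) @\<^sub>v 0\<^sub>v (n - 1)) = 2 * n"
    using n by (simp add: ones_vec_def)
  then obtain d where d: "D = mat_diag (2 * n) d"
    unfolding assms(14) diag_of_vec_def by metis
  have "two_sided_eigenvector_mat (M ^\<^sub>m 2) P"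
    using two_sided_eigenvector_matI[OF M2_car P_car Q_car PQ QP MP[unfolded d] PM[unfolded d]] .
  thus ?thesis
    using MP PM PQ QP P_car Q_car by (simp add: inverts_mat_def)
qed

end
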